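(* Let $V$ be a simple $\mathcal{R}$-module. If there exists a nonzero vector $v\in V$ such that $\mathcal{R}_+v=0$, then $V$ is a highest weight $\mathcal{R}$-module.
   Context: The Ramond algebra $\mathcal{R}=\mathcal{R}_{\bar 0}\oplus\mathcal{R}_{\bar 1}$ is the Lie superalgebra with basis $\{L_m,G_m,c\mid m\in\mathbb{Z}\}$, where $\mathcal{R}_{\bar 0}=\mathrm{span}\{L_m,c\}$, $\mathcal{R}_{\bar 1}=\mathrm{span}\{G_m\}$, and brackets $[L_m,L_n]=(m-n)L_{m+n}+\delta_{m+n,0}\frac{m^3-m}{12}c$, $[L_m,G_n]=(\frac m2-n)G_{m+n}$, $[G_m,G_n]=2L_{m+n}+\frac13\delta_{m+n,0}(m^2-\frac14)c$, $[\mathcal{R},c]=0$. $\mathcal{R}_+=\mathrm{span}\{L_m,G_m\mid m\in\mathbb{Z}_+\}$. Modules are $\mathbb{Z}_2$-graded (super)modules. A highest weight $\mathcal{R}$-module is a module generated by a nonzero vector $w$ with $\mathcal{R}_+w=0$, $L_0w=\lambda w$ and $cw=l w$ for some $\lambda,l\in\mathbb{C}$. *)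

theory Defs
  imports Complex_Main
begin

text \<open>A Z2-graded module V over the Ramond algebra. The underlying complex vector
space is the type 'v with scalar multiplication sc (a complex vector space);
V0, V1 are the even and odd parts with V = V0 (+) V1 (direct sum).
The action of the basis elements L_m, G_m, c is given by the operators
L m, G m, C.\<close>

definition ramond_module ::
  "(complex \<Rightarrow> 'v::ab_group_add \<Rightarrow> 'v) \<Rightarrow> 'v set \<Rightarrow> 'v set \<Rightarrow>
   (int \<Rightarrow> 'v \<Rightarrow> 'v) \<Rightarrow> (int \<Rightarrow> 'v \<Rightarrow> 'v) \<Rightarrow> ('v \<Rightarrow> 'v) \<Rightarrow> bool" where
  "ramond_module sc V0 V1 L G C \<longleftrightarrow>
     vector_space sc \<and>
     module.subspace sc V0 \<and> module.subspace sc V1 \<and>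
     (\<forall>v. \<exists>a\<in>V0. \<exists>b\<in>V1. v = a + b) \<and> V0 \<inter> V1 = {0} \<and>
     (\<forall>m. Vector_Spaces.linear sc sc (L m)) \<and>
     (\<forall>m. Vector_Spaces.linear sc sc (G m)) \<and>
     Vector_Spaces.linear sc sc C \<and>
     \<comment> \<open>parity: L_m and c are even, G_m is odd\<close>
     (\<forall>m. L m ` V0 \<subseteq> V0 \<and> L m ` V1 \<subseteq> V1) \<and>
     (\<forall>m. G m ` V0 \<subseteq> V1 \<and> G m ` V1 \<subseteq> V0) \<and>
     C ` V0 \<subseteq> V0 \<and> C ` V1 \<subseteq> V1 \<and>
     \<comment> \<open>[L_m, L_n] = (m-n) L_{m+n} + delta_{m+n,0} (m^3-m)/12 c\<close>
     (\<forall>m n v. L m (L n v) - L n (L m v) =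
        sc (of_int m - of_int n) (L (m + n) v) +
        (if m + n = 0 then sc ((of_int m ^ 3 - of_int m) / 12) (C v) else 0)) \<and>
     \<comment> \<open>[L_m, G_n] = (m/2 - n) G_{m+n}\<close>
     (\<forall>m n v. L m (G n v) - G n (L m v) =
        sc (of_int m / 2 - of_int n) (G (m + n) v)) \<and>
     \<comment> \<open>[G_m, G_n] = G_m G_n + G_n G_m = 2 L_{m+n} + 1/3 delta_{m+n,0} (m^2 - 1/4) c\<close>
     (\<forall>m n v. G m (G n v) + G n (G m v) =
        sc 2 (L (m + n) v) +
        (if m + n = 0 then sc ((of_int m ^ 2 - 1 / 4) / 3) (C v) else 0)) \<and>
     \<comment> \<open>c is central\<close>
     (\<forall>m v. L m (C v) = C (L m v)) \<and>
     (\<forall>m v. G m (C v) = C (G m v))"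

definition ramond_submodule ::
  "(complex \<Rightarrow> 'v::ab_group_add \<Rightarrow> 'v) \<Rightarrow>
   (int \<Rightarrow> 'v \<Rightarrow> 'v) \<Rightarrow> (int \<Rightarrow> 'v \<Rightarrow> 'v) \<Rightarrow> ('v \<Rightarrow> 'v) \<Rightarrow> 'v set \<Rightarrow> bool" where
  "ramond_submodule sc L G C W \<longleftrightarrow>
     module.subspace sc W \<and> (\<forall>m. L m ` W \<subseteq> W) \<and> (\<forall>m. G m ` W \<subseteq> W) \<and> C ` W \<subseteq> W"

definition ramond_graded_submodule ::
  "(complex \<Rightarrow> 'v::ab_group_add \<Rightarrow> 'v) \<Rightarrow> 'v set \<Rightarrow> 'v set \<Rightarrow>
   (int \<Rightarrow> 'v \<Rightarrow> 'v) \<Rightarrow> (int \<Rightarrow> 'v \<Rightarrow> 'v) \<Rightarrow> ('v \<Rightarrow> 'v) \<Rightarrow> 'v set \<Rightarrow> bool" where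
  "ramond_graded_submodule sc V0 V1 L G C W \<longleftrightarrow>
     ramond_submodule sc L G C W \<and>
     (\<forall>w\<in>W. \<exists>a\<in>W \<inter> V0. \<exists>b\<in>W \<inter> V1. w = a + b)"

definition ramond_simple ::
  "(complex \<Rightarrow> 'v::ab_group_add \<Rightarrow> 'v) \<Rightarrow> 'v set \<Rightarrow> 'v set \<Rightarrow>
   (int \<Rightarrow> 'v \<Rightarrow> 'v) \<Rightarrow> (int \<Rightarrow> 'v \<Rightarrow> 'v) \<Rightarrow> ('v \<Rightarrow> 'v) \<Rightarrow> bool" where
  "ramond_simple sc V0 V1 L G C \<longleftrightarrow>
     ramond_module sc V0 V1 L G C \<and> (\<exists>v::'v. v \<noteq> 0) \<and>
     (\<forall>W. ramond_graded_submodule sc V0 V1 L G C W \<longrightarrow> W = {0} \<or> W = UNIV)"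

definition ramond_generated ::
  "(complex \<Rightarrow> 'v::ab_group_add \<Rightarrow> 'v) \<Rightarrow>
   (int \<Rightarrow> 'v \<Rightarrow> 'v) \<Rightarrow> (int \<Rightarrow> 'v \<Rightarrow> 'v) \<Rightarrow> ('v \<Rightarrow> 'v) \<Rightarrow> 'v \<Rightarrow> 'v set" where
  "ramond_generated sc L G C w = \<Inter> {W. ramond_submodule sc L G C W \<and> w \<in> W}"

text \<open>R_+ w = 0, where R_+ = span{L_m, G_m | m > 0}.\<close>
definition ramond_plus_annihilated ::
  "(int \<Rightarrow> 'v \<Rightarrow> 'v::ab_group_add) \<Rightarrow> (int \<Rightarrow> 'v \<Rightarrow> 'v) \<Rightarrow> 'v \<Rightarrow> bool" where
  "ramond_plus_annihilated L G w \<longleftrightarrow> (\<forall>m>0. L m w = 0 \<and> G m w = 0)"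

definition ramond_highest_weight ::
  "(complex \<Rightarrow> 'v::ab_group_add \<Rightarrow> 'v) \<Rightarrow> 'v set \<Rightarrow> 'v set \<Rightarrow>
   (int \<Rightarrow> 'v \<Rightarrow> 'v) \<Rightarrow> (int \<Rightarrow> 'v \<Rightarrow> 'v) \<Rightarrow> ('v \<Rightarrow> 'v) \<Rightarrow> bool" where
  "ramond_highest_weight sc V0 V1 L G C \<longleftrightarrow>
     ramond_module sc V0 V1 L G C \<and>
     (\<exists>w. w \<noteq> 0 \<and> ramond_plus_annihilated L G w \<and>
        (\<exists>lam. L 0 w = sc lam w) \<and> (\<exists>l. C w = sc l w) \<and>
        ramond_generated sc L G C w = UNIV)"

end

theory Submission
  imports Defs
    "HOL-Computational_Algebra.Fundamental_Theorem_Algebra"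
    "HOL-Analysis.Continuum_Not_Denumerable"
begin

text \<open>By Dixmier's version of Schur's lemma $c$ acts as a scalar. Suppose that $L_0$ has no
  eigenvector among the singular vectors (those killed by $\mathcal{R}_+$), so that
  $\mathbb{C}[L_0]$ acts on them without torsion, and let $w$ be a homogeneous singular vector.
  Let $U_n$ be obtained from $\mathbb{C}[L_0] w + \mathbb{C}[L_0] G_0 w$ by lowering the degree by $n$.

  For $n > 0$ there is no singular vector $s \neq 0$ in $U_n$: the operator
  $\sum_m L_{-m} L_m + m G_{-m} G_m$ kills $s$, but it agrees with $2 n L_0$ on $U_n$ up to terms of
  lower order, where $L_0$ has order $2$ and the other generators have order $1$. Hence multiplying
  $s$ by $L_0$ raises its order by at most $1$ instead of $2$, which is impossible in a finitely
  generated $\mathbb{C}[L_0]$-module. Applying $\mathcal{R}_+$ to a shortest relation then shows that the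
  sum of the $U_n$ is direct. So the vectors $(L_0 - n) x$ with $x \in U_n$ span a submodule,
  which is everything by simplicity. Comparing components in $U_0$ gives
  $w \in L_0 \mathbb{C}[L_0] w$, contradicting torsion-freeness.\<close>

section \<open>Polynomials in a linear operator\<close>

locale linear_operator = vector_space scale
  for scale :: "'a::field \<Rightarrow> 'v::ab_group_add \<Rightarrow> 'v" (infixr "*s" 75) +
  fixes T :: "'v \<Rightarrow> 'v"
  assumes T_add: "T (x + y) = T x + T y" and T_scale: "T (a *s x) = a *s T x"
begin

lemma T_zero [simp]: "T 0 = 0"
  using T_scale [of 0 0] by simp

lemma T_minus: "T (- x) = - T x"
  using T_scale [of "- 1" x] by simp

lemma T_diff: "T (x - y) = T x - T y"
  using T_add [of "x - y" y] by simp

lemma T_sum: "T (sum f A) = (\<Sum>a\<in>A. T (f a))"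
  by (induct A rule: infinite_finite_induct) (simp_all add: T_add)

lemma T_span:
  assumes "x \<in> span S" "\<And>y. y \<in> S \<Longrightarrow> T y \<in> span S"
  shows "T x \<in> span S"
  using assms(1)
  by (induct rule: span_induct_alt) (simp_all add: assms(2) T_add T_scale span_zero span_add span_scale)

text \<open>This is the evaluation p(T) v by Horner's scheme, which makes the space a module over
  the polynomial ring.\<close>

definition pact :: "'a poly \<Rightarrow> 'v \<Rightarrow> 'v" where
  "pact p = fold_coeffs (\<lambda>a f v. a *s v + T (f v)) p (\<lambda>v. 0)"

lemma pact_0 [simp]: "pact 0 v = 0"
  by (simp add: pact_def)

lemma pact_pCons [simp]: "pact (pCons a p) v = a *s v + T (pact p v)"
proof (cases "p = 0 \<and> a = 0")
  case False
  then show ?thesis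
    by (cases "p = 0") (simp_all add: pact_def)
qed simp

lemma pact_1 [simp]: "pact 1 v = v"
  by (simp add: one_pCons)

lemma pact_add: "pact (p + q) v = pact p v + pact q v"
  by (induct p q rule: poly_induct2) (simp_all add: T_add scale_left_distrib)

lemma pact_smult: "pact (smult a p) v = a *s pact p v"
  by (induct p) (simp_all add: T_scale scale_right_distrib)

lemma pact_diff: "pact (p - q) v = pact p v - pact q v"
  using pact_add [of "p - q" q v] by simp

lemma pact_sum: "pact (sum f A) v = (\<Sum>a\<in>A. pact (f a) v)"
  by (induct A rule: infinite_finite_induct) (simp_all add: pact_add)

lemma pact_mult: "pact (p * q) v = pact p (pact q v)"
  by (induct p) (simp_all add: pact_add pact_smult)

lemma pact_vec_add: "pact p (u + v) = pact p u + pact p v"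
  by (induct p) (simp_all add: T_add scale_right_distrib)

lemma pact_vec_scale: "pact p (a *s v) = a *s pact p v"
  by (induct p) (simp_all add: T_scale scale_right_distrib mult.commute)

lemma pact_vec_zero [simp]: "pact p 0 = 0"
  by (induct p) simp_all

lemma pact_vec_sum: "pact p (sum f A) = (\<Sum>a\<in>A. pact p (f a))"
  by (induct A rule: infinite_finite_induct) (simp_all add: pact_vec_add)

lemma pact_monom: "pact (monom 1 k) v = (T ^^ k) v"
  by (induct k) (simp_all add: monom_0 monom_Suc)

text \<open>A substitute for a $K(x)$-linear functional that does not vanish on $s$.\<close>

lemma torsion_free_degree_bound:
  assumes "finite B" and tf: "\<And>q. pact q s = 0 \<Longrightarrow> q = 0"
  shows "\<exists>c. \<forall>q p d. pact q s = (\<Sum>e\<in>B. pact (p e) e) \<longrightarrow> (\<forall>e\<in>B. degree (p e) \<le> d) \<longrightarrow> degree q \<le> d + c"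
  using \<open>finite B\<close>
proof induct
  case empty
  then show ?case by (intro exI [of _ 0]) (auto dest: tf)
next
  case (insert b B)
  then obtain c where c: "\<And>q p d. pact q s = (\<Sum>e\<in>B. pact (p e) e) \<Longrightarrow> (\<And>e. e \<in> B \<Longrightarrow> degree (p e) \<le> d) \<Longrightarrow> degree q \<le> d + c"
    by blast
  show ?case
  proof (cases "\<exists>q0 p0. pact q0 s = (\<Sum>e\<in>insert b B. pact (p0 e) e) \<and> p0 b \<noteq> 0")
    case False
    show ?thesis
    proof (intro exI [of _ c] allI impI)
      fix q p d
      assume q: "pact q s = (\<Sum>e\<in>insert b B. pact (p e) e)" and d: "\<forall>e\<in>insert b B. degree (p e) \<le> d"
      with False have "p b = 0" by blast
      with q insert.hyps have "pact q s = (\<Sum>e\<in>B. pact (p e) e)" by simp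
      then show "degree q \<le> d + c" using c d by blast
    qed
  next
    case True
    then obtain q0 p0 where q0: "pact q0 s = (\<Sum>e\<in>insert b B. pact (p0 e) e)" and p0: "p0 b \<noteq> 0"
      by blast
    define M where "M = Max ((\<lambda>e. degree (p0 e)) ` insert b B)"
    have M: "degree (p0 e) \<le> M" if "e \<in> insert b B" for e
      unfolding M_def using insert.hyps that by (intro Max_ge) auto
    show ?thesis
    proof (intro exI [of _ "c + M + degree q0"] allI impI)
      fix q p d
      assume q: "pact q s = (\<Sum>e\<in>insert b B. pact (p e) e)" and d: "\<forall>e\<in>insert b B. degree (p e) \<le> d"
      \<comment> \<open>Cross-multiplying the two relations cancels the coefficient of
        \<open>b\<close>, so the bound for \<open>B\<close> applies to \<open>r\<close>.\<close>
      define r where "r = p0 b * q - p b * q0"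
      have "pact r s = (\<Sum>e\<in>insert b B. pact (p0 b * p e - p b * p0 e) e)"
        by (simp only: r_def pact_diff pact_mult q q0 pact_vec_sum sum_subtractf)
      also have "\<dots> = (\<Sum>e\<in>B. pact (p0 b * p e - p b * p0 e) e)"
        using insert.hyps by (simp add: mult.commute)
      finally have "degree r \<le> (d + M) + c"
      proof (rule c)
        fix e assume "e \<in> B"
        then have "degree (p0 b * p e) \<le> d + M" "degree (p b * p0 e) \<le> d + M"
          using M [of b] M [of e] d degree_mult_le [of "p0 b" "p e"] degree_mult_le [of "p b" "p0 e"]
          by force+
        then show "degree (p0 b * p e - p b * p0 e) \<le> d + M"
          by (rule degree_diff_le)
      qed
      moreover have "degree (p b * q0) \<le> d + degree q0"
        using d degree_mult_le [of "p b" q0] by force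
      moreover have "degree (p0 b * q) \<le> max (degree r) (degree (p b * q0))"
        using degree_add_le_max [of r "p b * q0"] by (simp add: r_def)
      moreover have "degree q \<le> degree (p0 b * q)"
        using p0 by (cases "q = 0") (simp_all add: degree_mult_eq)
      ultimately show "degree q \<le> d + (c + M + degree q0)"
        by linarith
    qed
  qed
qed

end

section \<open>Torsion and eigenvectors over the complex numbers\<close>

locale complex_linear_operator = linear_operator scale T
  for scale :: "complex \<Rightarrow> 'v::ab_group_add \<Rightarrow> 'v" (infixr "*s" 75) and T
begin

text \<open>An annihilating polynomial has a root \<open>a\<close>; its cofactor either kills
  \<open>v\<close> too and has smaller degree, or maps \<open>v\<close> to an eigenvector. Giving
  the eigenvector as \<open>pact q v\<close> lets it inherit singularity from
  \<open>v\<close>.\<close>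

lemma eigenvector_if_torsion:
  assumes "pact g v = 0" "g \<noteq> 0" "v \<noteq> 0"
  shows "\<exists>a q. pact q v \<noteq> 0 \<and> T (pact q v) = a *s pact q v"
  using assms
proof (induct "degree g" arbitrary: g rule: less_induct)
  case less
  show ?case
  proof (cases "degree g = 0")
    case True
    then obtain c where "g = [:c:]" using degree_eq_zeroE by blast
    with less show ?thesis by simp
  next
    case False
    then obtain a where "poly g a = 0"
      using fundamental_theorem_of_algebra [of g] constant_degree [of g] by auto
    then obtain q where q: "g = [:-a, 1:] * q"
      using poly_eq_0_iff_dvd by blast
    with less.prems have "q \<noteq> 0" by auto
    then have "degree g = Suc (degree q)"
      unfolding q by (subst degree_mult_eq) auto
    show ?thesis
    proof (cases "pact q v = 0")
      case True
      then show ?thesis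
        using less.hyps [of q] \<open>degree g = Suc (degree q)\<close> \<open>q \<noteq> 0\<close> \<open>v \<noteq> 0\<close> by simp
    next
      case False
      have "T (pact q v) - a *s pact q v = pact g v"
        unfolding q pact_mult by simp
      then show ?thesis using False less.prems by auto
    qed
  qed
qed

text \<open>Dixmier's argument: otherwise the vectors $(T - a)^{-1} v$ would be uncountably many
  linearly independent ones.\<close>

lemma torsion_if_countably_spanned:
  assumes "countable S" and S: "span S = UNIV" and v: "v \<noteq> 0"
    and surj: "\<And>a. \<exists>y. T y - a *s y = v"
  shows "\<exists>g. g \<noteq> 0 \<and> pact g v = 0"
proof (rule ccontr)
  assume "\<not> ?thesis"
  then have tf: "g = 0" if "pact g v = 0" for g
    using that by blast
  obtain y where y: "T (y a) - a *s y a = v" for a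
    using surj by metis
  have inj: "inj y"
  proof (rule injI)
    fix a b assume ab: "y a = y b"
    have "T (y b) - a *s y b = T (y b) - b *s y b"
      using y [of a] y [of b] ab by simp
    moreover have "y b \<noteq> 0" using y [of b] v by auto
    ultimately show "a = b" by simp
  qed
  \<comment> \<open>\<open>P A\<close> clears the denominators of all (T - a)^{-1} v with
    \<open>a\<close> in \<open>A\<close>.\<close>
  define P where "P A = (\<Prod>a\<in>A. [:-a, 1:])" for A :: "complex set"
  have Py: "pact (P A) (y a) = pact (P (A - {a})) v" if "finite A" "a \<in> A" for A a
  proof -
    have "P A = P (A - {a}) * [:-a, 1:]"
      unfolding P_def by (subst prod.remove [OF that]) (rule mult.commute)
    then have "pact (P A) (y a) = pact (P (A - {a})) (pact [:-a, 1:] (y a))"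
      by (simp only: pact_mult)
    also have "pact [:-a, 1:] (y a) = v" using y [of a] by simp
    finally show ?thesis .
  qed
  \<comment> \<open>Applying \<open>P A\<close> turns the relation into a polynomial that kills
    \<open>v\<close> and hence is zero; at \<open>a0\<close> only the summand of \<open>a0\<close>
    survives.\<close>
  have lin: "b a0 = 0" if "finite A" "(\<Sum>a\<in>A. b a *s y a) = 0" "a0 \<in> A" for A b a0
  proof -
    have "pact (\<Sum>a\<in>A. smult (b a) (P (A - {a}))) v = (\<Sum>a\<in>A. b a *s pact (P A) (y a))"
      using Py that(1) by (auto simp: pact_sum pact_smult intro: sum.cong)
    also have "\<dots> = pact (P A) (\<Sum>a\<in>A. b a *s y a)"
      by (simp add: pact_vec_sum pact_vec_scale)
    finally have "(\<Sum>a\<in>A. smult (b a) (P (A - {a}))) = 0"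
      using tf that by simp
    then have "0 = poly (\<Sum>a\<in>A. smult (b a) (P (A - {a}))) a0" by simp
    also have "\<dots> = (\<Sum>a\<in>A. b a * (\<Prod>c\<in>A - {a}. a0 - c))"
      by (simp add: poly_sum P_def poly_prod)
    also have "\<dots> = (\<Sum>a\<in>{a0}. b a * (\<Prod>c\<in>A - {a}. a0 - c))"
      using that by (intro sum.mono_neutral_right) auto
    finally show ?thesis using that by auto
  qed
  have indep: "independent (range y)"
    unfolding independent_explicit_module
  proof (intro allI impI)
    fix t u x assume "finite t" "t \<subseteq> range y" and 0: "(\<Sum>z\<in>t. u z *s z) = 0" and "x \<in> t"
    then obtain A where A: "t = y ` A" by (metis subset_imageE)
    have "inj_on y A" using inj by (rule inj_on_subset) simp
    then have "finite A" using A \<open>finite t\<close> finite_imageD by blast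
    have "(\<Sum>a\<in>A. u (y a) *s y a) = 0"
      using 0 unfolding A by (simp add: sum.reindex [OF \<open>inj_on y A\<close>])
    then show "u x = 0"
      using lin [OF \<open>finite A\<close>, of "\<lambda>a. u (y a)"] \<open>x \<in> t\<close> A by auto
  qed
  have fin: "finite {a. y a \<in> span F}" if "finite F" for F
  proof -
    have "independent (y ` {a. y a \<in> span F})"
      using indep by (rule independent_mono) auto
    then have "finite (y ` {a. y a \<in> span F})"
      using independent_span_bound [OF that] by blast
    then show ?thesis
      using inj by (meson finite_imageD inj_on_subset subset_UNIV)
  qed
  \<comment> \<open>\<open>S\<close> has only countably many finite subsets, the span of each
    contains only finitely many \<open>y a\<close>, and every \<open>y a\<close> lies in one of
    these spans.\<close>
  have "countable (\<Union>F\<in>{F. finite F \<and> F \<subseteq> S}. {a. y a \<in> span F})"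
    using \<open>countable S\<close> fin by (intro countable_UN countable_Collect_finite_subset) (auto intro: countable_finite)
  moreover have "(\<Union>F\<in>{F. finite F \<and> F \<subseteq> S}. {a. y a \<in> span F}) = UNIV"
  proof -
    have "\<exists>F. finite F \<and> F \<subseteq> S \<and> y a \<in> span F" for a
    proof -
      have "y a \<in> span S" using S by simp
      then obtain F r where "finite F" "F \<subseteq> S" "y a = (\<Sum>z\<in>F. r z *s z)"
        unfolding span_explicit by auto
      moreover from this have "y a \<in> span F"
        by (simp add: span_sum span_scale span_base)
      ultimately show ?thesis by blast
    qed
    then show ?thesis by auto
  qed
  ultimately have "countable (UNIV :: complex set)" by simp
  then have "countable (range complex_of_real)"
    by (rule countable_subset [rotated]) simp
  then have "countable (UNIV :: real set)"
    by (rule countable_image_inj_on) (simp add: inj_of_real)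
  then show False using uncountable_UNIV_real by blast
qed

end

section \<open>Simple modules over the Ramond algebra\<close>

locale simple_ramond = vector_space sc
  for sc :: "complex \<Rightarrow> 'v::ab_group_add \<Rightarrow> 'v" (infixr "*s" 75) +
  fixes V0 V1 :: "'v set" and L G :: "int \<Rightarrow> 'v \<Rightarrow> 'v" and C :: "'v \<Rightarrow> 'v"
  assumes simple: "ramond_simple sc V0 V1 L G C"
begin

section \<open>Commutation relations and parity\<close>

lemma ramond_module: "ramond_module sc V0 V1 L G C"
  using simple by (simp add: ramond_simple_def)

sublocale L: complex_linear_operator sc "L m" for m
  using ramond_module
  by unfold_locales (auto simp: ramond_module_def Vector_Spaces.linear_iff)

sublocale G: complex_linear_operator sc "G m" for m
  using ramond_module
  by unfold_locales (auto simp: ramond_module_def Vector_Spaces.linear_iff)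

sublocale C: complex_linear_operator sc C
  using ramond_module
  by unfold_locales (auto simp: ramond_module_def Vector_Spaces.linear_iff)

lemmas op_linear =
  L.T_add L.T_diff L.T_minus L.T_scale G.T_add G.T_diff G.T_minus G.T_scale C.T_add C.T_diff C.T_minus C.T_scale

text \<open>The brackets are solved for one product, so that they serve as rules for reordering
  generators.\<close>

lemma LL: "L m (L n v) = L n (L m v) + (of_int m - of_int n) *s L (m + n) v +
    (if m + n = 0 then ((of_int m ^ 3 - of_int m) / 12) *s C v else 0)"
proof -
  have "L m (L n v) - L n (L m v) = (of_int m - of_int n) *s L (m + n) v +
      (if m + n = 0 then ((of_int m ^ 3 - of_int m) / 12) *s C v else 0)"
    using ramond_module by (simp add: ramond_module_def)
  then show ?thesis by (simp only: diff_eq_eq add_ac)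
qed

lemma LG: "L m (G n v) = G n (L m v) + (of_int m / 2 - of_int n) *s G (m + n) v"
proof -
  have "L m (G n v) - G n (L m v) = (of_int m / 2 - of_int n) *s G (m + n) v"
    using ramond_module by (simp add: ramond_module_def)
  then show ?thesis by (simp only: diff_eq_eq add_ac)
qed

lemma GL: "G n (L m v) = L m (G n v) - (of_int m / 2 - of_int n) *s G (m + n) v"
  by (simp add: LG)

lemma GG: "G m (G n v) = - G n (G m v) + 2 *s L (m + n) v +
    (if m + n = 0 then ((of_int m ^ 2 - 1 / 4) / 3) *s C v else 0)"
proof -
  have "G m (G n v) + G n (G m v) = 2 *s L (m + n) v +
      (if m + n = 0 then ((of_int m ^ 2 - 1 / 4) / 3) *s C v else 0)"
    using ramond_module by (simp add: ramond_module_def)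
  then show ?thesis by (simp add: eq_diff_eq [symmetric])
qed

lemma C_central: "C (L m v) = L m (C v)" "C (G m v) = G m (C v)"
  using ramond_module unfolding ramond_module_def by auto

lemma subspace_parts: "subspace V0" "subspace V1"
  using ramond_module unfolding ramond_module_def by auto

lemma parity:
  "x \<in> V0 \<Longrightarrow> L m x \<in> V0" "x \<in> V1 \<Longrightarrow> L m x \<in> V1"
  "x \<in> V0 \<Longrightarrow> G m x \<in> V1" "x \<in> V1 \<Longrightarrow> G m x \<in> V0"
  "x \<in> V0 \<Longrightarrow> C x \<in> V0" "x \<in> V1 \<Longrightarrow> C x \<in> V1"
  using ramond_module by (simp_all add: ramond_module_def image_subset_iff)

lemma obtain_parts:
  obtains a b where "v = a + b" "a \<in> V0" "b \<in> V1"
proof -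
  have "\<exists>a\<in>V0. \<exists>b\<in>V1. v = a + b"
    using ramond_module by (simp add: ramond_module_def)
  then show thesis using that by blast
qed

lemma parts_unique:
  assumes "a \<in> V0" "b \<in> V1" "a + b = 0"
  shows "a = 0" "b = 0"
proof -
  have "a = - b" using assms(3) by (simp add: eq_neg_iff_add_eq_0)
  then have "a \<in> V0 \<inter> V1" using assms subspace_parts subspace_neg by blast
  moreover have "V0 \<inter> V1 = {0}" using ramond_module by (simp add: ramond_module_def)
  ultimately show "a = 0" by simp
  then show "b = 0" using assms(3) by simp
qed

section \<open>Consequences of simplicity\<close>

text \<open>Simplicity speaks of graded submodules only, so it is applied to \<open>W'\<close>, the
  largest graded submodule inside \<open>W\<close>; homogeneity puts \<open>u\<close> into
  \<open>W'\<close>.\<close>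

lemma submodule_eq_UNIV:
  assumes W: "ramond_submodule sc L G C W" and u: "u \<in> W" "u \<in> V0 \<union> V1" "u \<noteq> 0"
  shows "W = UNIV"
proof -
  have sub: "subspace W" and WL: "\<And>m x. x \<in> W \<Longrightarrow> L m x \<in> W" and WG: "\<And>m x. x \<in> W \<Longrightarrow> G m x \<in> W"
    and WC: "\<And>x. x \<in> W \<Longrightarrow> C x \<in> W"
    using W by (auto simp: ramond_submodule_def image_subset_iff)
  define W' where "W' = {x + y |x y. x \<in> W \<inter> V0 \<and> y \<in> W \<inter> V1}"
  have sub': "subspace W'"
    unfolding W'_def by (intro subspace_sums subspace_inter sub subspace_parts)
  have even: "x \<in> W'" if "x \<in> W" "x \<in> V0" for x
    unfolding W'_def using that subspace_0 [OF sub] subspace_0 [OF subspace_parts(2)] by force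
  have odd: "x \<in> W'" if "x \<in> W" "x \<in> V1" for x
    unfolding W'_def using that subspace_0 [OF sub] subspace_0 [OF subspace_parts(1)] by force
  have closed: "f x \<in> W'"
    if "x \<in> W'" and f: "\<And>x y. f (x + y) = f x + f y" "\<And>x. x \<in> W \<Longrightarrow> f x \<in> W"
      "\<And>x. x \<in> V0 \<union> V1 \<Longrightarrow> f x \<in> V0 \<union> V1" for f x
  proof -
    obtain a b where ab: "x = a + b" "a \<in> W" "a \<in> V0" "b \<in> W" "b \<in> V1"
      using \<open>x \<in> W'\<close> unfolding W'_def by blast
    then have "f a \<in> W'" "f b \<in> W'" using f(2,3) [of a] f(2,3) [of b] even odd by blast+
    then show ?thesis using ab f(1) subspace_add [OF sub'] by simp
  qed
  have "L m x \<in> W'" "G m x \<in> W'" "C x \<in> W'" if "x \<in> W'" for m x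
    using closed [OF that, of "L m"] closed [OF that, of "G m"] closed [OF that, of C] parity WL WG WC
    by (simp_all add: op_linear) blast+
  then have "ramond_submodule sc L G C W'"
    unfolding ramond_submodule_def using sub' by auto
  moreover have "\<exists>a\<in>W' \<inter> V0. \<exists>b\<in>W' \<inter> V1. x = a + b" if x: "x \<in> W'" for x
  proof -
    obtain a b where "x = a + b" "a \<in> W" "a \<in> V0" "b \<in> W" "b \<in> V1"
      using x unfolding W'_def by blast
    then show ?thesis using even odd by blast
  qed
  ultimately have "ramond_graded_submodule sc V0 V1 L G C W'"
    unfolding ramond_graded_submodule_def by blast
  then have "W' = {0} \<or> W' = UNIV"
    using simple unfolding ramond_simple_def by blast
  moreover have "u \<in> W'" using u even odd by blast
  ultimately have "W' = UNIV" using u(3) by auto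
  moreover have "W' \<subseteq> W" unfolding W'_def using subspace_add [OF sub] by auto
  ultimately show ?thesis by auto
qed

text \<open>The images of \<open>u\<close> under the countably many words in the generators span a
  submodule.\<close>

lemma countably_spanned:
  assumes "u \<in> V0 \<union> V1" "u \<noteq> 0"
  shows "\<exists>S. countable S \<and> span S = UNIV"
proof -
  \<comment> \<open>Generators are coded by pairs so that the lists of codes form a countable type;
    first entries other than 0 and 1 stand for \<open>C\<close>.\<close>
  define f where "f p = (if fst p = 0 then L (snd p) else if fst p = 1 then G (snd p) else C)"
    for p :: "nat \<times> int"
  define S where "S = range (\<lambda>ps. foldr f ps u)"
  have f: "f p x \<in> S" if x: "x \<in> S" for p x
  proof -
    obtain ps where "x = foldr f ps u" using x unfolding S_def by blast
    then have "f p x = foldr f (p # ps) u" by simp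
    then show ?thesis unfolding S_def by blast
  qed
  have closed: "L m x \<in> S" "G m x \<in> S" "C x \<in> S" if "x \<in> S" for m x
    using f [OF that, of "(0, m)"] f [OF that, of "(1, m)"] f [OF that, of "(2, m)"]
    by (simp_all add: f_def)
  have "L m x \<in> span S" "G m x \<in> span S" "C x \<in> span S" if "x \<in> span S" for m x
    by (rule L.T_span [OF that] G.T_span [OF that] C.T_span [OF that]; simp add: closed span_base)+
  then have "ramond_submodule sc L G C (span S)"
    unfolding ramond_submodule_def by auto
  moreover have "u \<in> S" unfolding S_def by (rule range_eqI [of _ _ "[]"]) simp
  ultimately have "span S = UNIV"
    using submodule_eq_UNIV span_base assms by blast
  moreover have "countable S" unfolding S_def by simp
  ultimately show ?thesis by blast
qed

section \<open>Homogeneous components and Schur's lemma\<close>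

text \<open>What matters is that such a map has a graded kernel.\<close>

definition homogeneous_map :: "('v \<Rightarrow> 'v) \<Rightarrow> bool" where
  "homogeneous_map f \<longleftrightarrow> (\<forall>u v. f (u + v) = f u + f v) \<and>
    ((\<forall>x\<in>V0. f x \<in> V0) \<and> (\<forall>x\<in>V1. f x \<in> V1) \<or> (\<forall>x\<in>V0. f x \<in> V1) \<and> (\<forall>x\<in>V1. f x \<in> V0))"

lemma homogeneous_map_ops:
  "homogeneous_map (L m)" "homogeneous_map (G m)"
  "homogeneous_map (\<lambda>x. L m x - a *s x)" "homogeneous_map (\<lambda>x. C x - a *s x)"
  unfolding homogeneous_map_def
  by (auto simp: op_linear scale_right_distrib parity intro!: subspace_diff subspace_scale subspace_parts)

text \<open>One component \<open>z\<close> is fixed before \<open>f\<close>, so it satisfies all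
  homogeneous equations of \<open>y\<close> at once, such as singularity together with an eigenvalue
  equation.\<close>

lemma nonzero_part:
  assumes "y \<noteq> 0"
  shows "\<exists>z\<in>V0 \<union> V1. z \<noteq> 0 \<and> (\<forall>f. homogeneous_map f \<longrightarrow> f y = 0 \<longrightarrow> f z = 0)"
proof -
  obtain a b where ab: "y = a + b" "a \<in> V0" "b \<in> V1" by (rule obtain_parts)
  have parts: "f a = 0 \<and> f b = 0" if f: "homogeneous_map f" "f y = 0" for f
  proof -
    have "f a + f b = 0" using f ab unfolding homogeneous_map_def by simp
    moreover from this have "f b + f a = 0" by (simp add: add.commute)
    moreover have "f a \<in> V0 \<and> f b \<in> V1 \<or> f a \<in> V1 \<and> f b \<in> V0"
      using f ab unfolding homogeneous_map_def by auto
    ultimately show ?thesis using parts_unique by blast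
  qed
  show ?thesis
  proof (cases "a = 0")
    case True
    then show ?thesis using ab parts \<open>y \<noteq> 0\<close> by (intro bexI [of _ b]) auto
  next
    case False
    then show ?thesis using ab parts by (intro bexI [of _ a]) auto
  qed
qed

text \<open>Kernel and image of \<open>C\<close> minus a scalar are submodules. If \<open>C\<close>
  is not scalar, all these maps are therefore bijective, while countable dimension forces torsion
  and hence an eigenvector.\<close>

lemma C_scalar: "\<exists>l. \<forall>v. C v = l *s v"
proof (rule ccontr)
  assume no: "\<not> ?thesis"
  have "\<exists>y::'v. y \<noteq> 0" using simple unfolding ramond_simple_def by blast
  then obtain u where u: "u \<in> V0 \<union> V1" "u \<noteq> 0" using nonzero_part by blast
  have ker: "y = 0" if y: "C y = a *s y" for a y
  proof (rule ccontr)
    assume "y \<noteq> 0"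
    then obtain z where z: "z \<in> V0 \<union> V1" "z \<noteq> 0"
      and f: "\<And>f. homogeneous_map f \<Longrightarrow> f y = 0 \<Longrightarrow> f z = 0"
      using nonzero_part by blast
    have "C z - a *s z = 0"
      using f [OF homogeneous_map_ops(4) [of a]] y by simp
    moreover have "ramond_submodule sc L G C {x. C x = a *s x}"
      unfolding ramond_submodule_def
      by (auto simp: subspace_def op_linear C_central scale_right_distrib mult.commute)
    ultimately have "{x. C x = a *s x} = UNIV"
      using submodule_eq_UNIV [of _ z] z by simp
    then show False using no by blast
  qed
  have surj: "\<exists>y. C y - a *s y = v" for a v
  proof -
    have "subspace (range (\<lambda>x. C x - a *s x))"
    proof (rule subspaceI)
      show "0 \<in> range (\<lambda>x. C x - a *s x)" by (rule range_eqI [of _ _ 0]) simp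
      fix x y assume "x \<in> range (\<lambda>x. C x - a *s x)" "y \<in> range (\<lambda>x. C x - a *s x)"
      then obtain x' y' where "x = C x' - a *s x'" "y = C y' - a *s y'" by blast
      then show "x + y \<in> range (\<lambda>x. C x - a *s x)"
        by (intro range_eqI [of _ _ "x' + y'"]) (simp add: op_linear scale_right_distrib)
    next
      fix c x assume "x \<in> range (\<lambda>x. C x - a *s x)"
      then obtain x' where "x = C x' - a *s x'" by blast
      then show "c *s x \<in> range (\<lambda>x. C x - a *s x)"
        by (intro range_eqI [of _ _ "c *s x'"]) (simp add: op_linear scale_right_diff_distrib mult.commute)
    qed
    moreover have "L m (C x - a *s x) = C (L m x) - a *s L m x" "G m (C x - a *s x) = C (G m x) - a *s G m x"
      "C (C x - a *s x) = C (C x) - a *s C x" for m x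
      by (simp_all add: op_linear C_central)
    ultimately have "ramond_submodule sc L G C (range (\<lambda>x. C x - a *s x))"
      unfolding ramond_submodule_def by auto
    moreover have "C u - a *s u \<noteq> 0" using ker u by auto
    moreover have "C u - a *s u \<in> V0 \<union> V1"
      using u homogeneous_map_ops(4) [of a] unfolding homogeneous_map_def by blast
    ultimately have "range (\<lambda>x. C x - a *s x) = UNIV"
      using submodule_eq_UNIV by blast
    then have "v \<in> range (\<lambda>x. C x - a *s x)" by simp
    then show ?thesis by auto
  qed
  obtain S where "countable S" "span S = UNIV" using countably_spanned [OF u] by blast
  then obtain g where "g \<noteq> 0" "C.pact g u = 0"
    using C.torsion_if_countably_spanned [OF _ _ u(2) surj] by blast
  then show False using C.eigenvector_if_torsion u(2) ker by metis
qed

text \<open>The eigenvalue clause is conditional, so that an arbitrary singular vector can also be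
  replaced by a homogeneous one.\<close>

lemma homogeneous_singular_eigenvector:
  assumes "u \<noteq> 0" "ramond_plus_annihilated L G u"
  obtains z where "z \<in> V0 \<union> V1" "z \<noteq> 0" "ramond_plus_annihilated L G z"
    "\<And>a. L 0 u = a *s u \<Longrightarrow> L 0 z = a *s z"
proof -
  obtain z where z: "z \<in> V0 \<union> V1" "z \<noteq> 0"
    and f: "\<And>f. homogeneous_map f \<Longrightarrow> f u = 0 \<Longrightarrow> f z = 0"
    using nonzero_part [OF assms(1)] by blast
  have "L m z = 0" "G m z = 0" if "m > 0" for m
    using assms(2) that f [OF homogeneous_map_ops(1) [of m]] f [OF homogeneous_map_ops(2) [of m]]
    by (simp_all add: ramond_plus_annihilated_def)
  moreover have "L 0 z = a *s z" if "L 0 u = a *s u" for a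
    using f [OF homogeneous_map_ops(3) [of 0 a]] that by simp
  ultimately show thesis using that [OF z] by (simp add: ramond_plus_annihilated_def)
qed

lemma highest_weight_if_singular_eigenvector:
  assumes "u \<noteq> 0" "ramond_plus_annihilated L G u" "L 0 u = a *s u"
  shows "ramond_highest_weight sc V0 V1 L G C"
proof -
  obtain z where z: "z \<in> V0 \<union> V1" "z \<noteq> 0" "ramond_plus_annihilated L G z" "L 0 z = a *s z"
    using homogeneous_singular_eigenvector assms by metis
  have "W = UNIV" if "ramond_submodule sc L G C W" "z \<in> W" for W
    using submodule_eq_UNIV that z by blast
  then have "ramond_generated sc L G C z = UNIV"
    unfolding ramond_generated_def by blast
  then show ?thesis
    unfolding ramond_highest_weight_def using ramond_module z C_scalar by blast
qed

end

section \<open>Modules without singular weight vectors\<close>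

text \<open>This is the situation to be refuted: a singular vector exists, but none is an
  eigenvector of \<open>L 0\<close>.\<close>

locale ramond_free_vacuum = simple_ramond sc V0 V1 L G C
  for sc :: "complex \<Rightarrow> 'v::ab_group_add \<Rightarrow> 'v" (infixr "*s" 75) and V0 V1 L G C +
  fixes w :: 'v and l :: complex
  assumes w_nonzero: "w \<noteq> 0" and w_homogeneous: "w \<in> V0 \<union> V1"
    and w_singular: "ramond_plus_annihilated L G w"
    and C_eq: "C v = l *s v"
    and no_eigenvector: "\<And>u a. ramond_plus_annihilated L G u \<Longrightarrow> L 0 u = a *s u \<Longrightarrow> u = 0"
begin

section \<open>Singular vectors\<close>

text \<open>The bracket of \<open>L 0\<close> with a raising generator is a multiple of that
  generator.\<close>

lemma singular_L0: "ramond_plus_annihilated L G u \<Longrightarrow> ramond_plus_annihilated L G (L 0 u)"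
  by (simp add: ramond_plus_annihilated_def LL [of _ 0] GL [of _ 0])

lemma singular_L0_power: "ramond_plus_annihilated L G u \<Longrightarrow> ramond_plus_annihilated L G ((L 0 ^^ i) u)"
  by (induct i) (simp_all add: singular_L0)

lemma singular_G0: "ramond_plus_annihilated L G u \<Longrightarrow> ramond_plus_annihilated L G (G 0 u)"
  by (simp add: ramond_plus_annihilated_def LG [of _ 0] GG [of _ 0])

lemma singular_pact: "ramond_plus_annihilated L G u \<Longrightarrow> ramond_plus_annihilated L G (L.pact 0 p u)"
proof (induct p)
  case 0
  then show ?case by (simp add: ramond_plus_annihilated_def)
next
  case (pCons a p)
  then have "ramond_plus_annihilated L G (L 0 (L.pact 0 p u))" by (simp add: singular_L0)
  with pCons show ?case by (simp add: ramond_plus_annihilated_def op_linear)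
qed

text \<open>Torsion would produce an eigenvector \<open>pact p u\<close>, which is again
  singular.\<close>

lemma singular_torsion_free:
  assumes "ramond_plus_annihilated L G u" "u \<noteq> 0" "L.pact 0 q u = 0"
  shows "q = 0"
proof (rule ccontr)
  assume "q \<noteq> 0"
  then obtain a p where "L.pact 0 p u \<noteq> 0" "L 0 (L.pact 0 p u) = a *s L.pact 0 p u"
    using L.eigenvector_if_torsion assms(2,3) by blast
  then show False using no_eigenvector singular_pact assms(1) by blast
qed

text \<open>Here \<open>n\<close> counts how far the degree is lowered below that of \<open>w\<close>, and \<open>d\<close> bounds the order,
  in which $L_0$ has weight $2$ and all other generators have weight $1$. To leading order,
  $L_m$, $L_{-m}$ and $G_m$, $G_{-m}$ then satisfy Heisenberg and Clifford relations over
  $\mathbb{C}[L_0]$.\<close>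

inductive filt :: "int \<Rightarrow> nat \<Rightarrow> 'v \<Rightarrow> bool" where
  zero: "filt n d 0"
| base: "2 * i \<le> d \<Longrightarrow> filt 0 d ((L 0 ^^ i) w)"
| base_G: "2 * i + 1 \<le> d \<Longrightarrow> filt 0 d ((L 0 ^^ i) (G 0 w))"
| lower_L: "0 < k \<Longrightarrow> filt n d x \<Longrightarrow> filt (n + k) (Suc d) (L (- k) x)"
| lower_G: "0 < k \<Longrightarrow> filt n d x \<Longrightarrow> filt (n + k) (Suc d) (G (- k) x)"
| add: "filt n d x \<Longrightarrow> filt n d y \<Longrightarrow> filt n d (x + y)"
| scale: "filt n d x \<Longrightarrow> filt n d (a *s x)"

section \<open>Order estimates for the generators\<close>

lemma filt_mono: "filt n d x \<Longrightarrow> d \<le> e \<Longrightarrow> filt n e x"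
proof (induct arbitrary: e rule: filt.induct)
  case (lower_L k n d x)
  then obtain e' where "e = Suc e'" "d \<le> e'" by (cases e) auto
  with lower_L show ?case by (simp add: filt.lower_L)
next
  case (lower_G k n d x)
  then obtain e' where "e = Suc e'" "d \<le> e'" by (cases e) auto
  with lower_G show ?case by (simp add: filt.lower_G)
qed (auto intro: filt.intros)

lemma filt_uminus: "filt n d x \<Longrightarrow> filt n d (- x)"
  using filt.scale [of n d x "- 1"] by simp

lemma filt_diff: "filt n d x \<Longrightarrow> filt n d y \<Longrightarrow> filt n d (x - y)"
  using filt.add [of n d x "- y"] filt_uminus by simp

lemma filt_sum: "(\<And>a. a \<in> A \<Longrightarrow> filt n d (f a)) \<Longrightarrow> filt n d (sum f A)"
  by (induct A rule: infinite_finite_induct) (auto intro: filt.intros)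

lemmas filt_linear = filt.zero filt.add filt.scale filt_diff filt_uminus

lemma filt_neg: "filt n d x \<Longrightarrow> n < 0 \<Longrightarrow> x = 0"
  by (induct rule: filt.induct) auto

lemma filt_lower:
  assumes "filt n d x" "0 < k" "n' = n + k" "Suc d \<le> e"
  shows "filt n' e (L (- k) x)" "filt n' e (G (- k) x)"
  using filt_mono [OF filt.lower_L [OF assms(2,1)] assms(4)] filt_mono [OF filt.lower_G [OF assms(2,1)] assms(4)]
  by (simp_all add: assms(3))

lemma filt_L0: "filt n d x \<Longrightarrow> filt n (d + 2) (L 0 x)"
proof (induct rule: filt.induct)
  case (base i d)
  then show ?case using filt.base [of "Suc i" "d + 2"] by simp
next
  case (base_G i d)
  then show ?case using filt.base_G [of "Suc i" "d + 2"] by simp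
next
  case (lower_L k n d x)
  then show ?case
    by (auto simp: LL [of 0] intro!: filt_linear filt_lower)
next
  case (lower_G k n d x)
  then show ?case
    by (auto simp: LG [of 0] intro!: filt_linear filt_lower)
qed (auto simp: op_linear intro: filt_linear)

text \<open>Up to a constant \<open>G 0\<close> is a square root of \<open>L 0\<close>, which fits
  the weights one and two.\<close>

lemma G0_sq: "G 0 (G 0 x) = L 0 x - (l / 24) *s x"
proof -
  have two: "y + y = 2 *s y" for y
    using scale_left_distrib [of 1 1 y] by simp
  have "G 0 (G 0 x) + G 0 (G 0 x) = 2 *s L 0 x - (l / 12) *s x"
    by (subst GG) (simp add: C_eq)
  then have "2 *s G 0 (G 0 x) = 2 *s (L 0 x - (l / 24) *s x)"
    by (simp add: two scale_right_diff_distrib)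
  then show ?thesis by (simp only: scale_cancel_left) simp
qed

lemma G0_L0_power: "G 0 ((L 0 ^^ i) x) = (L 0 ^^ i) (G 0 x)"
  by (induct i) (simp_all add: GL [of 0])

lemma L0_power_linear: "(L 0 ^^ i) (x - a *s y) = (L 0 ^^ i) x - a *s (L 0 ^^ i) y"
  by (induct i) (simp_all add: op_linear)

lemma filt_G0: "filt n d x \<Longrightarrow> filt n (Suc d) (G 0 x)"
proof (induct rule: filt.induct)
  case (base i d)
  then show ?case using filt.base_G [of i "Suc d"] by (simp add: G0_L0_power)
next
  case (base_G i d)
  have "filt 0 (Suc d) ((L 0 ^^ i) (L 0 w) - (l / 24) *s (L 0 ^^ i) w)"
    using base_G filt.base [of "Suc i" "Suc d"] filt.base [of i "Suc d"]
    by (intro filt_linear) (simp_all add: funpow_swap1)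
  then show ?case by (simp add: G0_L0_power G0_sq L0_power_linear)
next
  case (lower_L k n d x)
  then show ?case
    by (auto simp: GL intro!: filt_linear filt_lower)
next
  case (lower_G k n d x)
  then show ?case
    by (auto simp: GG [of 0] intro!: filt_linear filt_lower)
qed (auto simp: op_linear intro: filt_linear)

lemma filt_C: "filt n d x \<Longrightarrow> filt n d (C x)"
  by (simp add: C_eq filt.scale)

text \<open>The brackets in the induction for \<open>filt_raise\<close> have an index
  \<open>m - k\<close> of any sign, so the positive case is taken as a hypothesis.
  \<open>L j\<close> is allowed two orders because \<open>j\<close> may be 0.\<close>

lemma filt_shift_aux:
  assumes x: "filt n d x" and pos: "\<And>j. j > 0 \<Longrightarrow> filt (n - j) (Suc d) (L j x) \<and> filt (n - j) (Suc d) (G j x)"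
  shows "filt (n - j) (Suc (Suc d)) (L j x)" "filt (n - j) (Suc d) (G j x)"
proof -
  consider "j < 0" | "j = 0" | "j > 0" by linarith
  then have "filt (n - j) (Suc (Suc d)) (L j x) \<and> filt (n - j) (Suc d) (G j x)"
  proof cases
    case 1
    then show ?thesis
      using filt_lower [OF x, of "- j" "n - j"] by simp
  next
    case 2
    then show ?thesis
      using filt_L0 [OF x] filt_G0 [OF x] by simp
  next
    case 3
    then show ?thesis
      using pos filt_mono [of "n - j" "Suc d" "L j x" "Suc (Suc d)"] by simp
  qed
  then show "filt (n - j) (Suc (Suc d)) (L j x)" "filt (n - j) (Suc d) (G j x)" by auto
qed

text \<open>A raising operator is moved right until it meets a power of \<open>L 0\<close> on
  \<open>w\<close> or \<open>G 0 w\<close>, a singular vector. Each bracket with a lowering operator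
  replaces two generators of order one by a generator of order at most two, up to a scalar.\<close>

lemma filt_raise:
  "filt n d x \<Longrightarrow> m > 0 \<Longrightarrow> filt (n - m) (Suc d) (L m x) \<and> filt (n - m) (Suc d) (G m x)"
proof (induct arbitrary: m rule: filt.induct)
  case (base i d)
  have "ramond_plus_annihilated L G ((L 0 ^^ i) w)"
    using singular_L0_power [OF w_singular] .
  then show ?case using base by (simp add: ramond_plus_annihilated_def filt.zero)
next
  case (base_G i d)
  have "ramond_plus_annihilated L G ((L 0 ^^ i) (G 0 w))"
    using singular_L0_power [OF singular_G0 [OF w_singular]] .
  then show ?case using base_G by (simp add: ramond_plus_annihilated_def filt.zero)
next
  case (lower_L k n d x)
  have "filt (n + k - m) (Suc (Suc d)) (L (- k) (L m x))" "filt (n + k - m) (Suc (Suc d)) (L (- k) (G m x))"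
    using lower_L.hyps(3) [OF lower_L.prems]
      filt_lower [OF _ lower_L.hyps(1), of "n - m" "Suc d" _ "n + k - m" "Suc (Suc d)"] by simp_all
  moreover have "filt (n + k - m) (Suc (Suc d)) (L (m - k) x)" "filt (n + k - m) (Suc (Suc d)) (G (m - k) x)"
    using filt_shift_aux [OF lower_L.hyps(2,3), of "m - k"] filt_mono [of "n + k - m" "Suc d" "G (m - k) x" "Suc (Suc d)"]
    by (simp_all add: algebra_simps)
  moreover have "filt (n + k - m) (Suc (Suc d)) (if m = k then a *s C x else 0)" for a
    using filt_mono [OF lower_L.hyps(2), of "Suc (Suc d)"] by (auto intro: filt_linear filt_C)
  ultimately show ?case
    by (simp add: LL [of m "- k"] GL [of m "- k"] filt_linear)
next
  case (lower_G k n d x)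
  have "filt (n + k - m) (Suc (Suc d)) (G (- k) (L m x))" "filt (n + k - m) (Suc (Suc d)) (G (- k) (G m x))"
    using lower_G.hyps(3) [OF lower_G.prems]
      filt_lower [OF _ lower_G.hyps(1), of "n - m" "Suc d" _ "n + k - m" "Suc (Suc d)"] by simp_all
  moreover have "filt (n + k - m) (Suc (Suc d)) (L (m - k) x)" "filt (n + k - m) (Suc (Suc d)) (G (m - k) x)"
    using filt_shift_aux [OF lower_G.hyps(2,3), of "m - k"] filt_mono [of "n + k - m" "Suc d" "G (m - k) x" "Suc (Suc d)"]
    by (simp_all add: algebra_simps)
  moreover have "filt (n + k - m) (Suc (Suc d)) (if m = k then a *s C x else 0)" for a
    using filt_mono [OF lower_G.hyps(2), of "Suc (Suc d)"] by (auto intro: filt_linear filt_C)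
  ultimately show ?case
    by (simp add: LG [of m "- k"] GG [of m "- k"] filt_linear)
qed (simp_all add: op_linear filt_linear)

lemma filt_L: "filt n d x \<Longrightarrow> filt (n - j) (Suc (Suc d)) (L j x)"
  and filt_G: "filt n d x \<Longrightarrow> filt (n - j) (Suc d) (G j x)"
  using filt_shift_aux filt_raise by blast+

lemma filt_L_nonzero: "filt n d x \<Longrightarrow> j \<noteq> 0 \<Longrightarrow> filt (n - j) (Suc d) (L j x)"
  using filt_raise [of n d x j] filt_lower(1) [of n d x "- j"] by (cases "j > 0") auto

section \<open>The weighted number operator\<close>

text \<open>The factor \<open>m\<close> balances the two contractions: bracketing \<open>L m\<close>
  with \<open>L (- m)\<close> gives 2m L_0, bracketing \<open>G m\<close> with
  \<open>G (- m)\<close> only 2 L_0, up to central terms.\<close>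

definition euler_term :: "int \<Rightarrow> 'v \<Rightarrow> 'v" where
  "euler_term m x = L (- m) (L m x) + of_int m *s G (- m) (G m x)"

lemma euler_term_linear:
  "euler_term m (x + y) = euler_term m x + euler_term m y" "euler_term m (a *s x) = a *s euler_term m x"
  "euler_term m 0 = 0"
  by (simp_all add: euler_term_def op_linear scale_right_distrib mult.commute add_ac)

lemma GL_lower: "G n (L (- k) v) = L (- k) (G n v) + (of_int k / 2 + of_int n) *s G (n - k) v"
proof -
  have "of_int k / 2 + of_int n = - (of_int (- k) / 2 - of_int n :: complex)" by simp
  then show ?thesis by (simp only: GL scale_minus_left) simp
qed

text \<open>The commutator is grouped by order: the parenthesised block never involves
  \<open>L 0\<close>, whereas the last summand does exactly for \<open>m = k\<close>.\<close>

lemma euler_term_L: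
  assumes "0 < k" "0 < m"
  shows "euler_term m (L (- k) y) = L (- k) (euler_term m y)
    + ((of_int k - of_int m) *s L (- m - k) (L m y)
    + (of_int m * (of_int k / 2 - of_int m)) *s G (- m - k) (G m y)
    + (of_int m * (of_int k / 2 + of_int m)) *s G (- m) (G (m - k) y)
    + (if m = k then ((of_int m ^ 3 - of_int m) / 12 * l) *s L (- m) y else 0))
    + (of_int m + of_int k) *s L (- m) (L (m - k) y)"
proof -
  have [simp]: "- m \<noteq> k" "- m - k \<noteq> 0" using assms by auto
  have 1: "L (- m) (L m (L (- k) y)) = L (- k) (L (- m) (L m y)) + (of_int k - of_int m) *s L (- m - k) (L m y)
    + (of_int m + of_int k) *s L (- m) (L (m - k) y)
    + (if m = k then ((of_int m ^ 3 - of_int m) / 12 * l) *s L (- m) y else 0)"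
    unfolding LL [of m "- k" y] op_linear LL [of "- m" "- k" "L m y"]
    by (simp add: op_linear C_eq)
  have 2: "G (- m) (G m (L (- k) y)) = L (- k) (G (- m) (G m y))
     + (of_int k / 2 - of_int m) *s G (- m - k) (G m y) + (of_int k / 2 + of_int m) *s G (- m) (G (m - k) y)"
    unfolding GL_lower [of m k y] op_linear GL_lower [of "- m" k "G m y"]
    by simp
  show ?thesis
    unfolding euler_term_def 1 2 op_linear scale_right_distrib scale_scale
    by (simp only: add_ac)
qed

lemma euler_term_G:
  assumes "0 < k" "0 < m"
  shows "euler_term m (G (- k) y) = G (- k) (euler_term m y)
    + ((of_int k - of_int m / 2) *s G (- m - k) (L m y)
    + (of_int m / 2 + of_int k) *s L (- m) (G (m - k) y)
    - (2 * of_int m) *s L (- m - k) (G m y)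
    + (if m = k then ((of_int m ^ 2 - 1 / 4) / 3 * l * of_int m) *s G (- m) y else 0))
    + (2 * of_int m) *s G (- m) (L (m - k) y)"
proof -
  have [simp]: "- m \<noteq> k" "- m - k \<noteq> 0" using assms by auto
  have 1: "L (- m) (L m (G (- k) y)) = G (- k) (L (- m) (L m y)) + (of_int k - of_int m / 2) *s G (- m - k) (L m y)
    + (of_int m / 2 + of_int k) *s L (- m) (G (m - k) y)"
    unfolding LG [of m "- k" y] op_linear LG [of "- m" "- k" "L m y"]
    by (simp add: op_linear C_eq)
  have 2: "G (- m) (G m (G (- k) y)) = G (- k) (G (- m) (G m y))
     - 2 *s L (- m - k) (G m y) + 2 *s G (- m) (L (m - k) y)
    + (if m = k then ((of_int m ^ 2 - 1 / 4) / 3 * l) *s G (- m) y else 0)"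
    unfolding GG [of m "- k" y] op_linear GG [of "- m" "- k" "G m y"]
    by (simp add: op_linear C_eq)
  show ?thesis
    unfolding euler_term_def 1 2 op_linear scale_right_distrib scale_right_diff_distrib scale_scale
    by (auto simp: mult_ac)
qed

text \<open>The general bound for \<open>L 0 (L (- k) y)\<close> is order \<open>d + 3\<close>; once
  this main term is subtracted, all that remains has order at most \<open>d + 2\<close>.\<close>

lemma filt_euler_term_L:
  assumes y: "filt n d y" and "0 < k" "0 < m"
  shows "filt (n + k) (Suc (Suc d))
    (euler_term m (L (- k) y) - L (- k) (euler_term m y) - (if m = k then (2 * of_int k) *s L 0 (L (- k) y) else 0))"
proof -
  have yL: "filt (n - j) (Suc d) (L j y)" if "j \<noteq> 0" for j
    using filt_L_nonzero y that by blast
  have yG: "filt (n - j) (Suc d) (G j y)" for j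
    using filt_G y by blast
  have short: "filt (n + k) (Suc (Suc d)) (L (- m - k) (L m y))" "filt (n + k) (Suc (Suc d)) (G (- m - k) (G m y))"
    "filt (n + k) (Suc (Suc d)) (G (- m) (G (m - k) y))"
    using assms filt_lower(1) [OF yL, of m "m + k" "n + k"] filt_lower(2) [OF yG, of "m + k" "n + k" m]
      filt_lower(2) [OF yG, of m "n + k" "m - k"] by simp_all
  have yk: "filt (n + k) (Suc (Suc d)) (L (- k) y)"
    using assms filt_lower(1) by simp
  then have delta: "filt (n + k) (Suc (Suc d)) (if m = k then a *s L (- m) y else 0)" for a
    by (simp add: filt_linear)
  \<comment> \<open>For \<open>m = k\<close> the summand is the main term with \<open>L 0\<close> on
    the wrong side of \<open>L (- k)\<close>; moving it across leaves a multiple of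
    \<open>L (- k) y\<close>.\<close>
  have contraction: "filt (n + k) (Suc (Suc d)) ((of_int m + of_int k) *s L (- m) (L (m - k) y)
      - (if m = k then (2 * of_int k) *s L 0 (L (- k) y) else 0))"
  proof (cases "m = k")
    case True
    have "(of_int m + of_int k) *s L (- m) (L (m - k) y) - (2 * of_int k) *s L 0 (L (- k) y)
        = (- 2 * of_int k * of_int k) *s L (- k) y"
      by (simp add: True LL [of 0 "- k"] scale_right_distrib)
    with True show ?thesis using yk by (simp add: filt_linear)
  next
    case False
    then show ?thesis using assms filt_lower(1) [OF yL, of "m - k" m "n + k"] by (simp add: filt_linear)
  qed
  have "filt (n + k) (Suc (Suc d)) 
     (((of_int k - of_int m) *s L (- m - k) (L m y)
    + (of_int m * (of_int k / 2 - of_int m)) *s G (- m - k) (G m y)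
    + (of_int m * (of_int k / 2 + of_int m)) *s G (- m) (G (m - k) y)
    + (if m = k then ((of_int m ^ 3 - of_int m) / 12 * l) *s L (- m) y else 0))
    + ((of_int m + of_int k) *s L (- m) (L (m - k) y)
      - (if m = k then (2 * of_int k) *s L 0 (L (- k) y) else 0)))"
    by (intro filt.add [OF _ contraction] short delta filt.add filt.scale filt_diff)
  then show ?thesis
    unfolding euler_term_L [OF assms(2,3)] by (simp only: add_diff_eq add_diff_cancel_left' add.assoc)
qed

lemma filt_euler_term_G:
  assumes y: "filt n d y" and "0 < k" "0 < m"
  shows "filt (n + k) (Suc (Suc d))
    (euler_term m (G (- k) y) - G (- k) (euler_term m y) - (if m = k then (2 * of_int k) *s L 0 (G (- k) y) else 0))"
proof -
  have yL: "filt (n - j) (Suc d) (L j y)" if "j \<noteq> 0" for j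
    using filt_L_nonzero y that by blast
  have yG: "filt (n - j) (Suc d) (G j y)" for j
    using filt_G y by blast
  have short: "filt (n + k) (Suc (Suc d)) (G (- m - k) (L m y))" "filt (n + k) (Suc (Suc d)) (L (- m - k) (G m y))"
    "filt (n + k) (Suc (Suc d)) (L (- m) (G (m - k) y))"
    using assms filt_lower(2) [OF yL, of m "m + k" "n + k"] filt_lower(1) [OF yG, of "m + k" "n + k" m]
      filt_lower(1) [OF yG, of m "n + k" "m - k"] by simp_all
  have yk: "filt (n + k) (Suc (Suc d)) (G (- k) y)"
    using assms filt_lower(2) by simp
  then have delta: "filt (n + k) (Suc (Suc d)) (if m = k then a *s G (- m) y else 0)" for a
    by (simp add: filt_linear)
  have contraction: "filt (n + k) (Suc (Suc d)) ((2 * of_int m) *s G (- m) (L (m - k) y)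
      - (if m = k then (2 * of_int k) *s L 0 (G (- k) y) else 0))"
  proof (cases "m = k")
    case True
    have "(2 * of_int m) *s G (- m) (L (m - k) y) - (2 * of_int k) *s L 0 (G (- k) y)
        = (- 2 * of_int k * of_int k) *s G (- k) y"
      by (simp add: True LG [of 0 "- k"] scale_right_distrib)
    with True show ?thesis using yk by (simp add: filt_linear)
  next
    case False
    then show ?thesis using assms filt_lower(2) [OF yL, of "m - k" m "n + k"] by (simp add: filt_linear)
  qed
  have "filt (n + k) (Suc (Suc d)) 
     (((of_int k - of_int m / 2) *s G (- m - k) (L m y)
    + (of_int m / 2 + of_int k) *s L (- m) (G (m - k) y)
    - (2 * of_int m) *s L (- m - k) (G m y)
    + (if m = k then ((of_int m ^ 2 - 1 / 4) / 3 * l * of_int m) *s G (- m) y else 0))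
    + ((2 * of_int m) *s G (- m) (L (m - k) y)
      - (if m = k then (2 * of_int k) *s L 0 (G (- k) y) else 0)))"
    by (intro filt.add [OF _ contraction] short delta filt.add filt.scale filt_diff)
  then show ?thesis
    unfolding euler_term_G [OF assms(2,3)] by (simp only: add_diff_eq add_diff_cancel_left' add.assoc)
qed

lemma euler_term_singular: "ramond_plus_annihilated L G u \<Longrightarrow> 0 < m \<Longrightarrow> euler_term m u = 0"
  by (simp add: ramond_plus_annihilated_def euler_term_def)

lemma L0_lower:
  "L (- k) (L 0 y) = L 0 (L (- k) y) - of_int k *s L (- k) y"
  "G (- k) (L 0 y) = L 0 (G (- k) y) - of_int k *s G (- k) y"
  by (simp_all add: LL [of 0 "- k"] GL [of _ 0])

text \<open>To leading order $\sum_m L_{-m} L_m + m\, G_{-m} G_m$ is $2 L_0$ times the degree operator.\<close>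

lemma filt_euler:
  "filt n d x \<Longrightarrow> n \<le> M \<Longrightarrow>
    filt n (Suc d) ((\<Sum>m\<in>{1..M}. euler_term m x) - (2 * of_int n) *s L 0 x)"
\<comment> \<open>\<open>M\<close> may exceed the degree, because the hypothesis for degree
  \<open>n\<close> is used with the range that belongs to \<open>n + k\<close>.\<close>
proof (induct arbitrary: M rule: filt.induct)
  case zero
  then show ?case by (simp add: euler_term_linear filt.zero)
next
  case (base i d)
  have "(\<Sum>m\<in>{1..M}. euler_term m ((L 0 ^^ i) w)) = 0"
    using singular_L0_power [OF w_singular] by (intro sum.neutral) (auto intro: euler_term_singular)
  then show ?case by (simp add: filt.zero)
next
  case (base_G i d)
  have "(\<Sum>m\<in>{1..M}. euler_term m ((L 0 ^^ i) (G 0 w))) = 0"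
    using singular_L0_power [OF singular_G0 [OF w_singular]]
    by (intro sum.neutral) (auto intro: euler_term_singular)
  then show ?case by (simp add: filt.zero)
next
  case (lower_L k n d y)
  show ?case
  \<comment> \<open>For nonnegative \<open>n\<close> the index \<open>k\<close> lies in
    \<open>{1..M}\<close>, so exactly one summand of \<open>N\<close> carries the main term.\<close>
  proof (cases "n < 0")
    case True
    then have "y = 0" using filt_neg lower_L.hyps(2) by blast
    then show ?thesis by (simp add: euler_term_linear filt.zero)
  next
    case False
    define N where "N = (\<Sum>m\<in>{1..M}. euler_term m (L (- k) y) - L (- k) (euler_term m y)
      - (if m = k then (2 * of_int k) *s L 0 (L (- k) y) else 0))"
    have N: "filt (n + k) (Suc (Suc d)) N"
      unfolding N_def using lower_L.hyps by (intro filt_sum filt_euler_term_L) auto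
    have IH: "filt n (Suc d) ((\<Sum>m\<in>{1..M}. euler_term m y) - (2 * of_int n) *s L 0 y)"
      using lower_L by simp
    have "N = (\<Sum>m\<in>{1..M}. euler_term m (L (- k) y)) - L (- k) (\<Sum>m\<in>{1..M}. euler_term m y)
      - (2 * of_int k) *s L 0 (L (- k) y)"
      using lower_L False by (simp add: N_def sum_subtractf L.T_sum)
    \<comment> \<open>The main terms for \<open>n\<close> and \<open>k\<close> add up; moving
      \<open>L 0\<close> in front of \<open>L (- k)\<close> accounts for the last summand.\<close>
    then have "(\<Sum>m\<in>{1..M}. euler_term m (L (- k) y)) - (2 * of_int (n + k)) *s L 0 (L (- k) y)
      = N + L (- k) ((\<Sum>m\<in>{1..M}. euler_term m y) - (2 * of_int n) *s L 0 y)
        - (2 * of_int n * of_int k) *s L (- k) y"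
      by (simp add: op_linear L0_lower scale_right_diff_distrib scale_left_distrib distrib_left mult.assoc)
    moreover have "filt (n + k) (Suc (Suc d)) \<dots>"
      using lower_L.hyps
      by (intro filt_diff filt.add filt.scale N filt_lower(1) [OF IH] filt_lower(1) [OF lower_L.hyps(2)]) auto
    ultimately show ?thesis by simp
  qed
next
  case (lower_G k n d y)
  show ?case
  proof (cases "n < 0")
    case True
    then have "y = 0" using filt_neg lower_G.hyps(2) by blast
    then show ?thesis by (simp add: euler_term_linear filt.zero)
  next
    case False
    define N where "N = (\<Sum>m\<in>{1..M}. euler_term m (G (- k) y) - G (- k) (euler_term m y)
      - (if m = k then (2 * of_int k) *s L 0 (G (- k) y) else 0))"
    have N: "filt (n + k) (Suc (Suc d)) N"
      unfolding N_def using lower_G.hyps by (intro filt_sum filt_euler_term_G) auto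
    have IH: "filt n (Suc d) ((\<Sum>m\<in>{1..M}. euler_term m y) - (2 * of_int n) *s L 0 y)"
      using lower_G by simp
    have "N = (\<Sum>m\<in>{1..M}. euler_term m (G (- k) y)) - G (- k) (\<Sum>m\<in>{1..M}. euler_term m y)
      - (2 * of_int k) *s L 0 (G (- k) y)"
      using lower_G False by (simp add: N_def sum_subtractf G.T_sum)
    then have "(\<Sum>m\<in>{1..M}. euler_term m (G (- k) y)) - (2 * of_int (n + k)) *s L 0 (G (- k) y)
      = N + G (- k) ((\<Sum>m\<in>{1..M}. euler_term m y) - (2 * of_int n) *s L 0 y)
        - (2 * of_int n * of_int k) *s G (- k) y"
      by (simp add: op_linear L0_lower scale_right_diff_distrib scale_left_distrib distrib_left mult.assoc)
    moreover have "filt (n + k) (Suc (Suc d)) \<dots>"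
      using lower_G.hyps
      by (intro filt_diff filt.add filt.scale N filt_lower(2) [OF IH] filt_lower(2) [OF lower_G.hyps(2)]) auto
    ultimately show ?thesis by simp
  qed
next
  case (add n d x y)
  have "(\<Sum>m\<in>{1..M}. euler_term m (x + y)) - (2 * of_int n) *s L 0 (x + y)
    = ((\<Sum>m\<in>{1..M}. euler_term m x) - (2 * of_int n) *s L 0 x)
    + ((\<Sum>m\<in>{1..M}. euler_term m y) - (2 * of_int n) *s L 0 y)"
    by (simp add: euler_term_linear sum.distrib op_linear scale_right_distrib)
  then show ?case using add by (simp add: filt.add)
next
  case (scale n d x a)
  have "(\<Sum>m\<in>{1..M}. euler_term m (a *s x)) - (2 * of_int n) *s L 0 (a *s x)
    = a *s ((\<Sum>m\<in>{1..M}. euler_term m x) - (2 * of_int n) *s L 0 x)"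
    by (simp add: euler_term_linear scale_sum_right op_linear scale_right_diff_distrib mult_ac)
  then show ?case using scale by (simp add: filt.scale)
qed

section \<open>Finite generation over C[L_0]\<close>

text \<open>Words of degree \<open>n\<close> generate that degree over C[L_0]; inner powers of
  \<open>L 0\<close> are pushed into the coefficients on the left.\<close>

inductive word :: "int \<Rightarrow> 'v \<Rightarrow> bool" where
  word_0: "word 0 w"
| word_G: "word 0 (G 0 w)"
| word_lower_L: "0 < k \<Longrightarrow> word n x \<Longrightarrow> word (n + k) (L (- k) x)"
| word_lower_G: "0 < k \<Longrightarrow> word n x \<Longrightarrow> word (n + k) (G (- k) x)"

lemma word_nonneg: "word n x \<Longrightarrow> 0 \<le> n"
  by (induct rule: word.induct) auto

text \<open>The outermost letter has index between 1 and \<open>n\<close>, since the rest of the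
  word has nonnegative degree.\<close>

lemma finite_word: "finite {x. word n x}"
proof (induct "nat n" arbitrary: n rule: less_induct)
  case less
  have "{x. word n x} \<subseteq> {w, G 0 w} \<union> (\<Union>k\<in>{1..n}. L (- k) ` {x. word (n - k) x} \<union> G (- k) ` {x. word (n - k) x})"
  proof
    fix x assume "x \<in> {x. word n x}"
    then have "word n x" by simp
    then show "x \<in> {w, G 0 w} \<union> (\<Union>k\<in>{1..n}. L (- k) ` {x. word (n - k) x} \<union> G (- k) ` {x. word (n - k) x})"
    proof cases
      case (word_lower_L k n' y)
      moreover from this have "k \<in> {1..n}" using word_nonneg [of n' y] by simp
      ultimately show ?thesis by fastforce
    next
      case (word_lower_G k n' y)
      moreover from this have "k \<in> {1..n}" using word_nonneg [of n' y] by simp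
      ultimately show ?thesis by fastforce
    qed simp_all
  qed
  moreover have "finite ({w, G 0 w} \<union> (\<Union>k\<in>{1..n}. L (- k) ` {x. word (n - k) x} \<union> G (- k) ` {x. word (n - k) x}))"
    using less by (intro finite_UnI finite_UN_I finite_imageI) auto
  ultimately show ?case
    by (rule finite_subset)
qed

text \<open>Both operators raise eigenvalues of \<open>L 0\<close> by \<open>k\<close>, which
  explains the substitution; it preserves the degree of \<open>p\<close>.\<close>

lemma pact_lower:
  "L (- k) (L.pact 0 p x) = L.pact 0 (pcompose p [:- of_int k, 1:]) (L (- k) x)"
  "G (- k) (L.pact 0 p x) = L.pact 0 (pcompose p [:- of_int k, 1:]) (G (- k) x)"
  by (induct p)
    (simp_all add: pcompose_pCons op_linear L.pact_add L.pact_diff L.pact_smult L0_lower)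

text \<open>Since \<open>f\<close> may identify words, coefficients with the same image are
  added.\<close>

lemma regroup_pact:
  assumes "finite A" "finite B" "f ` A \<subseteq> B" "\<And>e. degree (p e) \<le> D"
  shows "\<exists>q. (\<forall>e. degree (q e) \<le> D) \<and> (\<Sum>e\<in>A. L.pact 0 (p e) (f e)) = (\<Sum>e\<in>B. L.pact 0 (q e) e)"
proof (intro exI conjI allI)
  fix e show "degree (\<Sum>x\<in>{x \<in> A. f x = e}. p x) \<le> D"
    using assms by (intro degree_sum_le) auto
next
  have "(\<Sum>e\<in>B. L.pact 0 (\<Sum>x\<in>{x \<in> A. f x = e}. p x) e)
    = (\<Sum>e\<in>B. \<Sum>x\<in>{x \<in> A. f x = e}. L.pact 0 (p x) (f x))"
    by (intro sum.cong refl) (simp add: L.pact_sum)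
  also have "\<dots> = (\<Sum>e\<in>A. L.pact 0 (p e) (f e))"
    using assms by (intro sum.group) auto
  finally show "(\<Sum>e\<in>A. L.pact 0 (p e) (f e)) = (\<Sum>e\<in>B. L.pact 0 (\<Sum>x\<in>{x \<in> A. f x = e}. p x) e)"
    by simp
qed

lemma regroup_pact_word:
  assumes "\<And>e. degree (p e) \<le> d div 2" "\<And>e. word n e \<Longrightarrow> word n' (f e)"
  shows "\<exists>q. (\<forall>e. degree (q e) \<le> Suc d div 2) \<and>
    (\<Sum>e\<in>{e. word n e}. L.pact 0 (pcompose (p e) [:- of_int k, 1:]) (f e)) = (\<Sum>e\<in>{e. word n' e}. L.pact 0 (q e) e)"
proof (rule regroup_pact [OF finite_word finite_word])
  show "degree (pcompose (p e) [:- of_int k, 1:]) \<le> Suc d div 2" for e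
    using order_trans [OF assms(1) [of e] div_le_mono [of d "Suc d" 2]] by (simp add: degree_pcompose)
qed (use assms(2) in auto)

text \<open>Every \<open>L 0\<close> costs two orders, so order \<open>d\<close> leaves room for at
  most \<open>d div 2\<close> of them; the other letters form the words.\<close>

lemma filt_finitely_generated:
  "filt n d x \<Longrightarrow> \<exists>p. (\<forall>e. degree (p e) \<le> d div 2) \<and> x = (\<Sum>e\<in>{e. word n e}. L.pact 0 (p e) e)"
proof (induct rule: filt.induct)
  case (zero n d)
  show ?case by (intro exI [of _ "\<lambda>e. 0"]) simp
next
  case (base i d)
  have "(\<Sum>e\<in>{e. word 0 e}. L.pact 0 (if e = w then monom 1 i else 0) e)
      = (\<Sum>e\<in>{e. word 0 e}. if e = w then L.pact 0 (monom 1 i) w else 0)"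
    by (intro sum.cong) auto
  then show ?case
    using base by (intro exI [of _ "\<lambda>e. if e = w then monom 1 i else 0"])
      (simp add: finite_word word_0 L.pact_monom degree_monom_eq)
next
  case (base_G i d)
  have "(\<Sum>e\<in>{e. word 0 e}. L.pact 0 (if e = G 0 w then monom 1 i else 0) e)
      = (\<Sum>e\<in>{e. word 0 e}. if e = G 0 w then L.pact 0 (monom 1 i) (G 0 w) else 0)"
    by (intro sum.cong) auto
  then show ?case
    using base_G by (intro exI [of _ "\<lambda>e. if e = G 0 w then monom 1 i else 0"])
      (simp add: finite_word word_G L.pact_monom degree_monom_eq)
next
  case (lower_L k n d x)
  then obtain p where p: "\<And>e. degree (p e) \<le> d div 2" "x = (\<Sum>e\<in>{e. word n e}. L.pact 0 (p e) e)" by blast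
  have "L (- k) x = (\<Sum>e\<in>{e. word n e}. L.pact 0 (pcompose (p e) [:- of_int k, 1:]) (L (- k) e))"
    by (simp add: p(2) L.T_sum pact_lower)
  then show ?case
    using regroup_pact_word [of p d n "n + k" "L (- k)" k] p(1) word_lower_L lower_L.hyps(1) by simp
next
  case (lower_G k n d x)
  then obtain p where p: "\<And>e. degree (p e) \<le> d div 2" "x = (\<Sum>e\<in>{e. word n e}. L.pact 0 (p e) e)" by blast
  have "G (- k) x = (\<Sum>e\<in>{e. word n e}. L.pact 0 (pcompose (p e) [:- of_int k, 1:]) (G (- k) e))"
    by (simp add: p(2) G.T_sum pact_lower)
  then show ?case
    using regroup_pact_word [of p d n "n + k" "G (- k)" k] p(1) word_lower_G lower_G.hyps(1) by simp
next
  case (add n d x y)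
  then obtain p q where "\<And>e. degree (p e) \<le> d div 2" "x = (\<Sum>e\<in>{e. word n e}. L.pact 0 (p e) e)"
    "\<And>e. degree (q e) \<le> d div 2" "y = (\<Sum>e\<in>{e. word n e}. L.pact 0 (q e) e)" by blast
  then show ?case
    by (intro exI [of _ "\<lambda>e. p e + q e"]) (simp add: L.pact_add sum.distrib degree_add_le)
next
  case (scale n d x a)
  then obtain p where "\<And>e. degree (p e) \<le> d div 2" "x = (\<Sum>e\<in>{e. word n e}. L.pact 0 (p e) e)" by blast
  then show ?case
    by (intro exI [of _ "\<lambda>e. smult a (p e)"])
      (auto simp: L.pact_smult scale_sum_right intro: order_trans [OF degree_smult_le])
qed

section \<open>Absence of singular vectors in positive degree\<close>

lemma no_lower_singular:
  assumes s: "ramond_plus_annihilated L G s" and "filt n d s" and "0 < n"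
  shows "s = 0"
proof (rule ccontr)
  assume "s \<noteq> 0"
  \<comment> \<open>The number operator kills singular vectors, so by \<open>filt_euler\<close>
    multiplication with \<open>2 * of_int n\<close> and \<open>L 0\<close> costs one order only;
    then divide by the nonzero scalar.\<close>
  have power: "filt n (d + k) ((L 0 ^^ k) s)" for k
  proof (induct k)
    case 0
    then show ?case using assms by simp
  next
    case (Suc k)
    have "(\<Sum>m\<in>{1..n}. euler_term m ((L 0 ^^ k) s)) = 0"
      using singular_L0_power [OF s] by (intro sum.neutral) (auto intro: euler_term_singular)
    then have "filt n (Suc (d + k)) (- ((2 * of_int n) *s L 0 ((L 0 ^^ k) s)))"
      using filt_euler [OF Suc order_refl] by simp
    then have "filt n (Suc (d + k)) (inverse (- 2 * of_int n) *s (- ((2 * of_int n) *s L 0 ((L 0 ^^ k) s))))"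
      by (rule filt.scale)
    then show ?case using \<open>0 < n\<close> by simp
  qed
  have "q = 0" if "L.pact 0 q s = 0" for q
    using singular_torsion_free [OF s \<open>s \<noteq> 0\<close> that] .
  from L.torsion_free_degree_bound [OF finite_word [of n] this] obtain c
    where c: "\<forall>q p D. L.pact 0 q s = (\<Sum>e\<in>{e. word n e}. L.pact 0 (p e) e) \<longrightarrow>
      (\<forall>e\<in>{e. word n e}. degree (p e) \<le> D) \<longrightarrow> degree q \<le> D + c" ..
  \<comment> \<open>This is the least \<open>k\<close> that violates
    \<open>k \<le> (d + k) div 2 + c\<close>.\<close>
  define k where "k = d + 2 * c + 1"
  obtain p where p: "\<And>e. degree (p e) \<le> (d + k) div 2"
      "L.pact 0 (monom 1 k) s = (\<Sum>e\<in>{e. word n e}. L.pact 0 (p e) e)"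
    using filt_finitely_generated [OF power [of k]] by (auto simp: L.pact_monom)
  have "degree (monom 1 k :: complex poly) \<le> (d + k) div 2 + c"
    using c p by blast
  then show False by (simp add: degree_monom_eq k_def)
qed

section \<open>Layers and their independence\<close>

definition layer :: "int \<Rightarrow> 'v set" where
  "layer n = {x. \<exists>d. filt n d x}"

lemma subspace_layer: "subspace (layer n)"
proof (rule subspaceI)
  fix x y assume "x \<in> layer n" "y \<in> layer n"
  then obtain d e where "filt n d x" "filt n e y" unfolding layer_def by blast
  then have "filt n (max d e) (x + y)" by (intro filt.add) (auto intro: filt_mono)
  then show "x + y \<in> layer n" unfolding layer_def by blast
qed (auto simp: layer_def intro: filt.intros)

lemma layer_closed: "x \<in> layer n \<Longrightarrow> L j x \<in> layer (n - j)" "x \<in> layer n \<Longrightarrow> G j x \<in> layer (n - j)"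
  unfolding layer_def using filt_L filt_G by blast+

lemma layer_neg: "x \<in> layer n \<Longrightarrow> n < 0 \<Longrightarrow> x = 0"
  unfolding layer_def using filt_neg by blast

text \<open>A raising operator shifts the relation to one on \<open>{0..N - m}\<close>, so by
  induction it kills every component. Components of positive degree are then singular and vanish,
  which leaves only \<open>f 0\<close>.\<close>

lemma layers_independent:
  assumes "\<And>j. f j \<in> layer j" "(\<Sum>j\<in>{0..N}. f j) = 0" "i \<in> {0..N}"
  shows "f i = 0"
  using assms
proof (induct "nat N" arbitrary: N f i rule: less_induct)
  case less
  have raise: "T m (f j) = 0"
    if T: "T = L \<or> T = G" and m: "0 < m" and j: "j \<in> {0..N}" for T m j
  proof (cases "j < m")
    case True
    then show ?thesis using T layer_closed less.prems(1) layer_neg [of "T m (f j)" "j - m"] by auto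
  next
    case False
    have layer: "T m (f i) \<in> layer (i - m)" for i
      using T layer_closed less.prems(1) by auto
    have "0 = T m (\<Sum>j\<in>{0..N}. f j)" using less.prems(2) T by auto
    also have "\<dots> = (\<Sum>j\<in>{0..N}. T m (f j))"
      using T by (auto simp: L.T_sum G.T_sum)
    \<comment> \<open>Components with index below \<open>m\<close> are sent to layers of negative
      index, which are zero.\<close>
    also have "\<dots> = (\<Sum>j\<in>{m..N}. T m (f j))"
    proof (rule sum.mono_neutral_right)
      show "\<forall>i\<in>{0..N} - {m..N}. T m (f i) = 0"
        using layer layer_neg by (metis DiffE atLeastAtMost_iff diff_less_0_iff_less not_le)
    qed (use m in auto)
    also have "\<dots> = (\<Sum>j\<in>{0..N - m}. T m (f (j + m)))"
      by (rule sum.reindex_bij_witness [of _ "\<lambda>j. j + m" "\<lambda>j. j - m"]) auto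
    finally have "(\<Sum>j\<in>{0..N - m}. T m (f (j + m))) = 0" ..
    moreover have "T m (f (i + m)) \<in> layer i" for i
      using layer [of "i + m"] by simp
    ultimately have "T m (f (j - m + m)) = 0"
      using m j False by (intro less.hyps [of "N - m" "\<lambda>j. T m (f (j + m))"]) auto
    then show ?thesis by simp
  qed
  have pos: "f j = 0" if "j \<in> {0<..N}" for j
  proof -
    have "ramond_plus_annihilated L G (f j)"
      using raise that by (auto simp: ramond_plus_annihilated_def)
    moreover obtain d where "filt j d (f j)" using less.prems(1) unfolding layer_def by blast
    ultimately show ?thesis using no_lower_singular that by simp
  qed
  have "0 \<le> N" using less.prems(3) by simp
  then have "{0..N} = insert 0 {0<..N}" by auto
  then have "f 0 = 0" using less.prems(2) pos by simp
  then show ?case using pos less.prems(3) by (cases "i = 0") auto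
qed

text \<open>A lowering operator could reach degree 0 only from a negative degree, where all vectors
  are zero.\<close>

lemma layer_0:
  assumes "x \<in> layer 0"
  shows "\<exists>p q. x = L.pact 0 p w + L.pact 0 q (G 0 w)"
proof -
  have "n = 0 \<longrightarrow> (\<exists>p q. x = L.pact 0 p w + L.pact 0 q (G 0 w))" if "filt n d x" for n d x
    using that
  proof (induct rule: filt.induct)
    case (zero n d)
    show ?case by (intro impI exI [of _ 0]) simp
  next
    case (base i d)
    show ?case by (intro impI exI [of _ "monom 1 i"] exI [of _ 0]) (simp add: L.pact_monom)
  next
    case (base_G i d)
    show ?case by (intro impI exI [of _ 0] exI [of _ "monom 1 i"]) (simp add: L.pact_monom)
  next
    case (lower_L k n d x)
    then have "n + k = 0 \<longrightarrow> x = 0" using filt_neg [of n d x] by auto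
    then show ?case by (auto intro!: exI [of _ 0])
  next
    case (lower_G k n d x)
    then have "n + k = 0 \<longrightarrow> x = 0" using filt_neg [of n d x] by auto
    then show ?case by (auto intro!: exI [of _ 0])
  next
    case (add n d x y)
    show ?case
    proof
      assume "n = 0"
      with add obtain p q p' q' where "x = L.pact 0 p w + L.pact 0 q (G 0 w)" "y = L.pact 0 p' w + L.pact 0 q' (G 0 w)"
        by blast
      then have "x + y = L.pact 0 (p + p') w + L.pact 0 (q + q') (G 0 w)"
        by (simp add: L.pact_add)
      then show "\<exists>p q. x + y = L.pact 0 p w + L.pact 0 q (G 0 w)" by blast
    qed
  next
    case (scale n d x a)
    show ?case
    proof
      assume "n = 0"
      with scale obtain p q where "x = L.pact 0 p w + L.pact 0 q (G 0 w)" by blast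
      then have "a *s x = L.pact 0 (smult a p) w + L.pact 0 (smult a q) (G 0 w)"
        by (simp add: L.pact_smult scale_right_distrib)
      then show "\<exists>p q. a *s x = L.pact 0 p w + L.pact 0 q (G 0 w)" by blast
    qed
  qed
  then show ?thesis using assms unfolding layer_def by blast
qed

lemma parity_pact: "x \<in> V0 \<Longrightarrow> L.pact 0 p x \<in> V0" "x \<in> V1 \<Longrightarrow> L.pact 0 p x \<in> V1"
  by (induct p) (auto intro!: subspace_add subspace_scale subspace_parts parity subspace_0)

text \<open>As \<open>w\<close> and \<open>G 0 w\<close> have opposite parity, the
  \<open>w\<close>-part of the equation vanishes separately; torsion-freeness would then make 1 a
  multiple of the indeterminate.\<close>

lemma w_not_in_L0_layer_0:
  assumes "x \<in> layer 0"
  shows "w \<noteq> L 0 x"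
proof
  assume w: "w = L 0 x"
  obtain p q where x: "x = L.pact 0 p w + L.pact 0 q (G 0 w)"
    using layer_0 assms by blast
  have "L.pact 0 (1 - pCons 0 p) w + (- L.pact 0 (pCons 0 q) (G 0 w)) = w - L 0 x"
    by (simp add: x L.pact_diff op_linear)
  then have "L.pact 0 (1 - pCons 0 p) w + (- L.pact 0 (pCons 0 q) (G 0 w)) = 0"
    using w by simp
  moreover from this have "- L.pact 0 (pCons 0 q) (G 0 w) + L.pact 0 (1 - pCons 0 p) w = 0"
    by (simp only: add.commute)
  moreover have "- L.pact 0 (pCons 0 q) (G 0 w) \<in> V1" if "w \<in> V0"
    by (intro subspace_neg subspace_parts parity_pact parity that)
  moreover have "- L.pact 0 (pCons 0 q) (G 0 w) \<in> V0" if "w \<in> V1"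
    by (intro subspace_neg subspace_parts parity_pact parity that)
  ultimately have "L.pact 0 (1 - pCons 0 p) w = 0"
    using w_homogeneous parity_pact [of w "1 - pCons 0 p"] parts_unique by blast
  then have "1 - pCons 0 p = 0"
    using singular_torsion_free w_singular w_nonzero by blast
  then have "poly (1 - pCons 0 p) 0 = 0" by simp
  then show False by simp
qed

text \<open>Since the layers are independent, $L_0 - j$ on the \<open>j\<close>-th layer is a module
  endomorphism of their sum; this is its image.\<close>

definition shifted_image :: "'v set" where
  "shifted_image = span {L 0 x - of_int j *s x |x j. x \<in> layer j}"

text \<open>\<open>L m\<close> and \<open>G m\<close> lower the layer index by \<open>m\<close> and
  shift the eigenvalues of \<open>L 0\<close> by the same amount, so generators go to
  generators.\<close>

lemma submodule_shifted_image: "ramond_submodule sc L G C shifted_image"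
proof -
  let ?S = "{L 0 x - of_int j *s x |x j. x \<in> layer j}"
  have L: "L m y \<in> ?S" and G: "G m y \<in> ?S" and C: "C y \<in> ?S" if S: "y \<in> ?S" for m y
  proof -
    obtain x j where y: "y = L 0 x - of_int j *s x" "x \<in> layer j" using S by blast
    have "L m y = L 0 (L m x) - of_int (j - m) *s L m x"
      by (simp add: y op_linear LL [of m 0] scale_left_diff_distrib)
    then show "L m y \<in> ?S" using layer_closed(1) [OF y(2)] by blast
    have "G m y = L 0 (G m x) - of_int (j - m) *s G m x"
      by (simp add: y op_linear GL [of m 0] scale_left_diff_distrib)
    then show "G m y \<in> ?S" using layer_closed(2) [OF y(2)] by blast
    have "C y = L 0 (C x) - of_int j *s C x"
      by (simp add: y op_linear C_central)
    moreover have "C x \<in> layer j"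
      using y(2) by (simp add: C_eq subspace_scale [OF subspace_layer])
    ultimately show "C y \<in> ?S" by blast
  qed
  have "L m y \<in> span ?S" "G m y \<in> span ?S" "C y \<in> span ?S" if y: "y \<in> span ?S" for m y
    by (rule L.T_span [OF y] G.T_span [OF y] C.T_span [OF y], rule span_base, rule L G C, assumption)+
  then show ?thesis
    unfolding ramond_submodule_def shifted_image_def using subspace_span by auto
qed

text \<open>Validity for all large \<open>M\<close> allows sums of different lengths to be
  added.\<close>

lemma shifted_imageE:
  assumes "y \<in> shifted_image"
  shows "\<exists>v N. (\<forall>j. v j \<in> layer j) \<and> (\<forall>M\<ge>N. y = (\<Sum>j\<in>{0..M}. L 0 (v j) - of_int j *s v j))"
proof -
  have layer0: "0 \<in> layer j" for j using subspace_0 [OF subspace_layer] .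
  show ?thesis
    using assms unfolding shifted_image_def
  proof (induct rule: span_induct_alt)
    case base
    show ?case using layer0 by (intro exI [of _ "\<lambda>j. 0"]) simp
  next
    case (step a x y)
    then obtain v N where v: "\<And>j. v j \<in> layer j" "\<And>M. M \<ge> N \<Longrightarrow> y = (\<Sum>j\<in>{0..M}. L 0 (v j) - of_int j *s v j)"
      by blast
    obtain x' i where x: "x = L 0 x' - of_int i *s x'" "x' \<in> layer i" using step by blast
    define v' where "v' j = (if j = i then a *s x' + v j else v j)" for j
    have "v' j \<in> layer j" for j
      using v(1) x(2) unfolding v'_def by (simp add: subspace_add subspace_scale subspace_layer)
    moreover have "a *s x + y = (\<Sum>j\<in>{0..M}. L 0 (v' j) - of_int j *s v' j)" if "M \<ge> max N i" for M
    \<comment> \<open>An index outside the summation range contributes nothing, since its layer is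
      zero.\<close>
    proof (cases "i < 0")
      case True
      then have "x' = 0" using x(2) layer_neg by blast
      then have "v' = v" by (auto simp: v'_def)
      then show ?thesis using x v(2) that \<open>x' = 0\<close> by simp
    next
      case False
      have "(\<Sum>j\<in>{0..M}. L 0 (v' j) - of_int j *s v' j)
        = (\<Sum>j\<in>{0..M}. (if j = i then a *s x else 0) + (L 0 (v j) - of_int j *s v j))"
        by (intro sum.cong) (auto simp: v'_def x op_linear scale_right_distrib scale_right_diff_distrib mult.commute)
      also have "\<dots> = a *s x + y"
        using False that v(2) [of M] by (simp add: sum.distrib)
      finally show ?thesis ..
    qed
    ultimately show ?case by blast
  qed
qed

lemma inconsistent: False
proof -
  have w: "w \<in> layer 0"
    using filt.base [of 0 0] unfolding layer_def by auto
  then have "L 0 w - of_int 0 *s w \<in> shifted_image"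
    unfolding shifted_image_def by (intro span_base) blast
  moreover have "L 0 w \<noteq> 0" using no_eigenvector [OF w_singular, of 0] w_nonzero by auto
  moreover have "L 0 w \<in> V0 \<union> V1" using w_homogeneous parity by blast
  ultimately have "shifted_image = UNIV"
    using submodule_eq_UNIV [OF submodule_shifted_image, of "L 0 w"] by simp
  then obtain v N where v: "\<And>j. v j \<in> layer j"
      "\<And>M. M \<ge> N \<Longrightarrow> w = (\<Sum>j\<in>{0..M}. L 0 (v j) - of_int j *s v j)"
    using shifted_imageE [of w] by blast
  \<comment> \<open>The expansion of \<open>w\<close> becomes a relation between layers, with
    \<open>w\<close> itself moved into layer 0.\<close>
  define f where "f j = L 0 (v j) - of_int j *s v j - (if j = 0 then w else 0)" for j :: int
  have "f j \<in> layer j" for j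
    using v(1) [of j] w layer_closed(1) [of "v j" j 0] subspace_0 [OF subspace_layer]
    unfolding f_def by (auto intro!: subspace_diff subspace_scale subspace_layer)
  \<comment> \<open>\<open>max N 0\<close> keeps index 0 in range even if \<open>N\<close> is
    negative.\<close>
  moreover have "(\<Sum>j\<in>{0..max N 0}. f j) = 0"
    using v(2) [of "max N 0"] by (simp add: f_def sum_subtractf)
  ultimately have "f 0 = 0"
    using layers_independent [of f "max N 0" 0] by simp
  then have "w = L 0 (v 0)" by (simp add: f_def)
  then show False using w_not_in_L0_layer_0 v(1) by blast
qed

end

theorem theorem4p1:
  fixes sc :: "complex \<Rightarrow> 'v::ab_group_add \<Rightarrow> 'v"
    and V0 V1 :: "'v set"
    and L G :: "int \<Rightarrow> 'v \<Rightarrow> 'v"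
    and C :: "'v \<Rightarrow> 'v"
  assumes "ramond_simple sc V0 V1 L G C"
    and "\<exists>v. v \<noteq> 0 \<and> ramond_plus_annihilated L G v"
  shows "ramond_highest_weight sc V0 V1 L G C"
proof (rule ccontr)
  assume no: "\<not> ?thesis"
  interpret vector_space sc
    using assms(1) by (simp add: ramond_simple_def ramond_module_def)
  interpret simple_ramond sc V0 V1 L G C
    using assms(1) by unfold_locales
  obtain w where w: "w \<in> V0 \<union> V1" "w \<noteq> 0" "ramond_plus_annihilated L G w"
    using assms(2) homogeneous_singular_eigenvector by metis
  obtain l where "\<And>v. C v = sc l v" using C_scalar by blast
  \<comment> \<open>By \<open>no\<close>, no singular vector can be an eigenvector of
    \<open>L 0\<close>, which supplies \<open>no_eigenvector\<close>.\<close>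
  then interpret ramond_free_vacuum sc V0 V1 L G C w l
    using w no highest_weight_if_singular_eigenvector by unfold_locales blast+
  show False by (rule inconsistent)
qed

end
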